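(* Let $ABCD$ be a parallelogram with center $O$ (the intersection of its diagonals), and let $f\colon ABCD\to\mathbb{R}$ be a function whose restrictions to the triangles $AOB$, $BOC$, $COD$ and $DOA$ are convex. Then $$\operatorname{Avg}(f,ABCD)\le\frac13\cdot\frac{f(A)+f(B)+f(C)+f(D)}{4}+\frac23\cdot\frac{\operatorname{Avg}(f,AC)+\operatorname{Avg}(f,BD)}{2}.$$
   Context: For a set $U$ which is a $k$-dimensional object (segment, polygon) and an integrable $f$, $\operatorname{Avg}(f,U)=\frac{1}{\operatorname{Vol}_k(U)}\int_U f$, with $\operatorname{Vol}_k$ the $k$-dimensional measure (length, area). For points $X,Y,\dots$, $\operatorname{Avg}(f,XY\dots)$ means $\operatorname{Avg}(f,\operatorname{conv}\{X,Y,\dots\})$. *)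

theory Defs
  imports "HOL-Analysis.Analysis"
begin

definition avg2 :: "(real^2 \<Rightarrow> real) \<Rightarrow> (real^2) set \<Rightarrow> real" where
  "avg2 f U = integral U f / measure lebesgue U"

text \<open>Average of f over the segment XY with respect to length,
  written via the affine arc-length-proportional parametrisation.\<close>
definition avg_seg :: "(real^2 \<Rightarrow> real) \<Rightarrow> real^2 \<Rightarrow> real^2 \<Rightarrow> real" where
  "avg_seg f X Y = integral {0..1} (\<lambda>t. f ((1 - t) *\<^sub>R X + t *\<^sub>R Y))"

end

theory Submission
  imports Defs
begin

text \<open>
  Cut the parallelogram into the four triangles with apex \<open>O\<close>. In a triangle \<open>OXY\<close>, a convex \<open>f\<close>
  lies on each chord parallel to \<open>XY\<close> below its secant, so the average of \<open>f\<close> is at most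
  \<open>\<integral> s (f (X\<^sub>s) + f (Y\<^sub>s)) ds\<close> over \<open>[0, 1]\<close>, where \<open>X\<^sub>s = O + s (X - O)\<close> and likewise \<open>Y\<^sub>s\<close>.
  For convex \<open>g\<close> on \<open>[0, 1]\<close> one has \<open>\<integral> s g(s) ds \<le> g(1)/6 + (\<integral> g)/3\<close>, because the secant \<open>l\<close> of \<open>g\<close>
  through \<open>1/3\<close> and \<open>1\<close> satisfies \<open>(s - 1/3) (g(s) - l(s)) \<le> 0\<close> and gives equality.
  The four triangles have equal area, so adding the resulting bounds yields the claim.
\<close>

section \<open>Integrability of convex functions on bounded sets\<close>

text \<open>Convexity gives continuity, hence measurability, only on the interior, so integrability
  is shown there first; the rest of \<open>S\<close> lies in its frontier, which is negligible for a
  convex set. The missing lower bound comes from reflecting points of \<open>S\<close> through a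
  fixed interior point.\<close>

lemma convex_on_absolutely_integrable:
  fixes f :: "'a::euclidean_space \<Rightarrow> real"
  assumes cf: "convex_on S f" and bS: "bounded S" and M: "\<And>x. x \<in> S \<Longrightarrow> f x \<le> M"
  shows "f absolutely_integrable_on S"
proof -
  have S: "convex S"
    using cf by (rule convex_on_imp_convex)
  have fr: "negligible (frontier S)"
    using S by (rule negligible_convex_frontier)
  have abs_int: "f absolutely_integrable_on interior S"
  proof (cases "interior S = {}")
    case False
    then obtain c where c: "c \<in> interior S" by blast
    then obtain e where e: "e > 0" "ball c e \<subseteq> S"
      by (auto simp: mem_interior)
    obtain B where B: "B > 0" "\<And>x. x \<in> S \<Longrightarrow> norm (x - c) \<le> B"
    proof -
      have "bounded ((\<lambda>x. x - c) ` S)"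
        using bS by (simp add: bounded_translation_minus)
      then show ?thesis
        using that by (auto simp: bounded_pos)
    qed
    \<comment> \<open>With this factor \<open>d * B = e / 2\<close>, so the reflected and shrunken
      point \<open>c - d *\<^sub>R (x - c)\<close> stays in the ball around \<open>c\<close>. Then
      \<open>c\<close> is a convex combination of that point and \<open>x\<close>; bounding
      \<open>f\<close> by \<open>M\<close> at the former and solving for \<open>f x\<close> gives
      \<open>L\<close>.\<close>
    define d where "d = e / (2 * B)"
    have d: "d > 0" using e B by (simp add: d_def)
    define L where "L = (f c * (1 + d) - M) / d"
    have L: "L \<le> f x" if x: "x \<in> S" for x
    proof -
      txt \<open>Continue the segment from \<open>x\<close> slightly beyond the interior point \<open>c\<close>.\<close>
      let ?y = "c - d *\<^sub>R (x - c)"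
      have "norm (d *\<^sub>R (x - c)) \<le> d * B"
        using B(2)[OF x] d by simp
      also have "d * B < e"
        using e B by (simp add: d_def)
      finally have y: "?y \<in> S"
        using e by (auto simp: dist_norm)
      have eq: "c = (1 / (1 + d)) *\<^sub>R ?y + (d / (1 + d)) *\<^sub>R x"
      proof -
        have "(1 + d) *\<^sub>R c = ?y + d *\<^sub>R x" by (simp add: algebra_simps)
        then have "(1 / (1 + d)) *\<^sub>R ((1 + d) *\<^sub>R c) = (1 / (1 + d)) *\<^sub>R (?y + d *\<^sub>R x)" by simp
        then show ?thesis using d by (simp add: scaleR_add_right)
      qed
      have "1 / (1 + d) + d / (1 + d) = 1"
        using d by (simp add: field_simps)
      then have "f c \<le> (1 / (1 + d)) * f ?y + (d / (1 + d)) * f x"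
        using cf y x d eq unfolding convex_on_def
        by (metis add_nonneg_nonneg divide_nonneg_nonneg less_eq_real_def zero_le_one)
      also have "\<dots> = (f ?y + d * f x) / (1 + d)"
        by (simp add: add_divide_distrib)
      finally have "f c * (1 + d) \<le> f ?y + d * f x"
        using d by (simp add: field_simps)
      then have "f c * (1 + d) - M \<le> d * f x"
        using M[OF y] by simp
      then show ?thesis
        using d by (simp add: L_def field_simps)
    qed
    show ?thesis
    proof (rule measurable_bounded_by_integrable_imp_absolutely_integrable)
      have "continuous_on (interior S) f"
        using cf convex_on_subset[OF cf interior_subset convex_interior[OF S]]
        by (intro convex_on_continuous) auto
      then show "f \<in> borel_measurable (lebesgue_on (interior S))"
        by (intro continuous_imp_measurable_on_sets_lebesgue) auto
      show "interior S \<in> sets lebesgue" by auto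
      have "interior S \<in> lmeasurable"
        using bS by (intro lmeasurable_open) (auto intro: bounded_interior)
      then show "(\<lambda>x. max \<bar>L\<bar> \<bar>M\<bar>) integrable_on interior S"
        by (rule integrable_on_const)
      show "norm (f x) \<le> max \<bar>L\<bar> \<bar>M\<bar>" if "x \<in> interior S" for x
        using L[of x] M[of x] that interior_subset[of S] by (auto simp: subset_iff)
    qed
  qed auto
  then show ?thesis
  proof (rule absolutely_integrable_spike_set)
    show "negligible {x \<in> interior S - S. f x \<noteq> 0}"
      using interior_subset[of S] by (auto intro: negligible_subset[OF negligible_empty])
    show "negligible {x \<in> S - interior S. f x \<noteq> 0}"
      using closure_subset[of S] by (intro negligible_subset[OF fr]) (auto simp: frontier_def)
  qed
qed

lemma convex_on_Icc_absolutely_integrable: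
  fixes g :: "real \<Rightarrow> real"
  assumes "convex_on {a..b} g"
  shows "g absolutely_integrable_on {a..b}"
proof (cases "a \<le> b")
  case True
  then have "convex hull {a, b} = {a..b}"
    by (simp add: segment_convex_hull[symmetric] closed_segment_eq_real_ivl)
  then have "\<forall>x\<in>{a..b}. g x \<le> max (g a) (g b)"
    using convex_on_convex_hull_bound[of "{a,b}" g "max (g a) (g b)"] assms by auto
  then show ?thesis
    using assms by (intro convex_on_absolutely_integrable) auto
qed auto

section \<open>A weighted integral inequality for convex functions on [0, 1]\<close>

lemma convex_on_integral_times_id_le:
  fixes g :: "real \<Rightarrow> real"
  assumes cg: "convex_on {0..1} g"
  shows "(\<lambda>s. s * g s) absolutely_integrable_on {0..1}"
    and "integral {0..1} (\<lambda>s. s * g s) \<le> g 1 / 6 + integral {0..1} g / 3"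
proof -
  have g: "g absolutely_integrable_on {0..1}"
    using cg by (rule convex_on_Icc_absolutely_integrable)
  show sg: "(\<lambda>s. s * g s) absolutely_integrable_on {0..1}"
  proof (rule absolutely_integrable_bounded_measurable_product_real[OF _ _ _ g])
    show "(\<lambda>s. s) \<in> borel_measurable (lebesgue_on {0..1::real})"
      by (intro continuous_imp_measurable_on_sets_lebesgue) auto
  qed auto
  \<comment> \<open>\<open>m\<close> is the slope of the secant through \<open>1/3\<close> and
    \<open>1\<close>, and \<open>l\<close> is that secant. Convexity puts \<open>g\<close> below
    \<open>l\<close> between the two nodes and above \<open>l\<close> to the left of
    \<open>1/3\<close>, exactly where the factor \<open>s - 1/3\<close> changes sign.\<close>
  define m where "m = (3/2) * (g 1 - g (1/3))"
  define l where "l s = g 1 + m * (s - 1)" for s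
  have le: "(s - 1/3) * g s \<le> (s - 1/3) * l s" if s: "s \<in> {0..1}" for s
  proof (cases "s \<ge> 1/3")
    case True
    have "g ((1 - (3 * s - 1)/2) *\<^sub>R (1/3) + ((3 * s - 1)/2) *\<^sub>R 1) \<le> (1 - (3 * s - 1)/2) * g (1/3) + ((3 * s - 1)/2) * g 1"
      by (rule convex_onD[OF cg]) (use True s in auto)
    moreover have "(1 - (3 * s - 1)/2) *\<^sub>R (1/3) + ((3 * s - 1)/2) *\<^sub>R (1::real) = s"
      by (simp add: field_simps)
    ultimately have "g s \<le> l s"
      by (simp add: l_def m_def field_simps)
    then show ?thesis using True by (intro mult_left_mono) auto
  next
    case False
    \<comment> \<open>\<open>r\<close> is the weight of \<open>1\<close> when \<open>1/3\<close> is
      written as a convex combination of \<open>s\<close> and \<open>1\<close>.\<close>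
    define r where "r = (1/3 - s) / (1 - s)"
    have r: "0 \<le> r" "r \<le> 1" "r * (1 - s) = 1/3 - s"
      using False s by (auto simp: r_def)
    have "g ((1 - r) *\<^sub>R s + r *\<^sub>R 1) \<le> (1 - r) * g s + r * g 1"
      by (rule convex_onD[OF cg]) (use r s in auto)
    moreover have "(1 - r) *\<^sub>R s + r *\<^sub>R 1 = 1/3"
      using r by (simp add: algebra_simps)
    ultimately have "g (1/3) \<le> (1 - r) * g s + r * g 1"
      by (simp only:)
    then have "g (1/3) * (1 - s) \<le> ((1 - r) * g s + r * g 1) * (1 - s)"
      using s by (intro mult_right_mono) auto
    also have "\<dots> = (1 - s) * g s - (r * (1 - s)) * g s + (r * (1 - s)) * g 1"
      by (simp add: algebra_simps)
    also have "\<dots> = (2/3) * g s + (1/3 - s) * g 1"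
      by (simp only: r(3)) (simp add: algebra_simps)
    finally have "l s \<le> g s"
      by (simp add: l_def m_def field_simps)
    then show ?thesis using False by (intro mult_left_mono_neg) auto
  qed
  have i1: "((\<lambda>s. (s - 1/3) * g s) has_integral integral {0..1} (\<lambda>s. s * g s) - integral {0..1} g / 3) {0..1}"
  proof -
    have "((\<lambda>s. s * g s - (1/3) * g s) has_integral integral {0..1} (\<lambda>s. s * g s) - (1/3) * integral {0..1} g) {0..1}"
      using g sg
      by (intro has_integral_diff has_integral_mult_right integrable_integral set_lebesgue_integral_eq_integral(1))
    then show ?thesis by (simp add: algebra_simps)
  qed
  \<comment> \<open>The node \<open>1/3\<close> is chosen so that the integral of
    \<open>(s - 1/3) * (s - 1)\<close> over [0, 1] is zero. The slope \<open>m\<close> therefore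
    drops out, and only \<open>g 1\<close> times the integral \<open>1/6\<close> of
    \<open>s - 1/3\<close> remains.\<close>
  have i2: "((\<lambda>s. (s - 1/3) * l s) has_integral g 1 / 6) {0..1}"
  proof -
    let ?P = "\<lambda>s. g 1 * (s^2 / 2 - s / 3) + m * (s^3 / 3 - 2 * s^2 / 3 + s / 3)"
    have "((\<lambda>s. (s - 1/3) * l s) has_integral ?P 1 - ?P 0) {0..1}"
      by (intro fundamental_theorem_of_calculus)
         (auto simp: l_def has_real_derivative_iff_has_vector_derivative[symmetric] power2_eq_square algebra_simps
            intro!: derivative_eq_intros)
    then show ?thesis by simp
  qed
  show "integral {0..1} (\<lambda>s. s * g s) \<le> g 1 / 6 + integral {0..1} g / 3"
    using has_integral_le[OF i1 i2 le] by simp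
qed

section \<open>Planar Lebesgue measure as a product measure\<close>

lemma borel_measurable_vector2:
  "(\<lambda>(x, y). vector [x, y] :: real^2) \<in> borel_measurable borel"
proof (intro borel_measurable_continuous_onI)
  have "(\<lambda>p. (\<chi> i. if i = 1 then fst p else snd p) :: real^2) = (\<lambda>(x, y). vector [x, y] :: real^2)"
    by (auto simp: fun_eq_iff vec_eq_iff forall_2)
  then show "continuous_on UNIV (\<lambda>(x, y). vector [x, y] :: real^2)"
  proof (rule subst[where P="continuous_on UNIV"])
    show "continuous_on UNIV (\<lambda>p. (\<chi> i. if i = 1 then fst p else snd p) :: real^2)"
    proof (intro continuous_intros)
      show "continuous_on UNIV (\<lambda>p::real \<times> real. if i = 1 then fst p else snd p)" for i :: 2
        by (cases "i = 1") (auto intro: continuous_intros)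
    qed
  qed
qed

text \<open>The two measures agree on boxes, which determines \<open>lborel\<close>. This makes
  Fubini on \<open>real \<times> real\<close> available for integrals over
  \<open>real^2\<close>.\<close>

lemma lborel_vec2:
  "(lborel :: (real^2) measure) = distr lborel borel (\<lambda>(x, y). vector [x, y])"
proof (rule lborel_eqI)
  let ?h = "\<lambda>(x, y). vector [x, y] :: real^2"
  have h: "?h \<in> borel_measurable borel"
    by (rule borel_measurable_vector2)
  fix l u :: "real^2"
  assume le: "\<And>b. b \<in> Basis \<Longrightarrow> l \<bullet> b \<le> u \<bullet> b"
  have le': "l $ i \<le> u $ i" for i
    using le[of "axis i 1"] by (auto simp: inner_axis)
  have "?h -` box l u = box (l$1) (u$1) \<times> box (l$2) (u$2)"
    by (auto simp: mem_box_cart forall_2)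
  then have "emeasure (distr lborel borel ?h) (box l u) = emeasure (lborel \<Otimes>\<^sub>M lborel) (box (l$1) (u$1) \<times> box (l$2) (u$2))"
    using h by (simp add: emeasure_distr lborel_prod)
  also have "\<dots> = ennreal (u$1 - l$1) * ennreal (u$2 - l$2)"
    by (subst lborel.emeasure_pair_measure_Times) (auto simp: le')
  also have "\<dots> = ennreal (prod ((\<bullet>) (u - l)) Basis)"
  proof -
    have "prod ((\<bullet>) (u - l)) Basis = (\<Prod>i\<in>UNIV. (u - l) $ i)"
      unfolding Basis_vec_def 
      by (subst prod.reindex_bij_betw[symmetric, where h="\<lambda>i. axis i 1" and S=UNIV])
         (auto simp: bij_betw_def inj_on_def axis_eq_axis inner_axis)
    then show ?thesis by (simp add: UNIV_2 ennreal_mult le')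
  qed
  finally show "emeasure (distr lborel borel ?h) (box l u) = ennreal (prod ((\<bullet>) (u - l)) Basis)" .
qed simp

section \<open>The bound on the standard triangle\<close>

text \<open>The apex is the origin and the opposite side is vertical, so the chords parallel to that
  side are the slices \<open>v$1 = s\<close>, of length \<open>s\<close>. Fubini in these
  coordinates integrates along precisely the chords needed.\<close>

definition standard_triangle :: "(real^2) set" where
  "standard_triangle = {v. 0 \<le> v$2 \<and> v$2 \<le> v$1 \<and> v$1 \<le> 1}"

lemma compact_standard_triangle: "compact standard_triangle"
proof -
  have eq: "standard_triangle = {v. 0 \<le> v$2} \<inter> {v. v$2 \<le> v$1} \<inter> {v. v$1 \<le> 1}"
    by (auto simp: standard_triangle_def)
  have "closed standard_triangle"
    unfolding eq by (intro closed_Int closed_Collect_le continuous_intros)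
  moreover have "standard_triangle \<subseteq> cbox 0 1"
    by (auto simp: standard_triangle_def mem_box_cart forall_2)
  then have "bounded standard_triangle"
    using bounded_cbox bounded_subset by blast
  ultimately show ?thesis
    by (simp add: compact_eq_bounded_closed)
qed

lemma standard_triangle_eq_hull:
  "standard_triangle = convex hull {0, vector [1, 0], vector [1, 1]}"
proof -
  \<comment> \<open>The barycentric weights of \<open>vector [1, 0]\<close> and
    \<open>vector [1, 1]\<close> are \<open>v$1 - v$2\<close> and \<open>v$2\<close>.\<close>
  have "v \<in> convex hull {0, vector [1, 0], vector [1, 1]}" if "v \<in> standard_triangle" for v :: "real^2"
    unfolding convex_hull_3_alt using that
    by - (rule CollectI, rule exI[of _ "v$1 - v$2"], rule exI[of _ "v$2"],
       auto simp: standard_triangle_def vec_eq_iff forall_2)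
  moreover have "v \<in> standard_triangle" if "v \<in> convex hull {0, vector [1, 0], vector [1, 1]}" for v :: "real^2"
    using that unfolding convex_hull_3_alt
    by (auto simp: standard_triangle_def)
  ultimately show ?thesis by blast
qed

lemma convex_on_standard_triangle_absolutely_integrable:
  assumes cF: "convex_on standard_triangle F"
  shows "F absolutely_integrable_on standard_triangle"
proof (rule convex_on_absolutely_integrable[OF cF])
  show "bounded standard_triangle"
    using compact_standard_triangle by (rule compact_imp_bounded)
  fix x assume x: "x \<in> standard_triangle"
  let ?M = "max (F 0) (max (F (vector [1, 0])) (F (vector [1, 1])))"
  have "\<forall>x\<in>convex hull {0, vector [1, 0], vector [1, 1]}. F x \<le> ?M"
    using cF unfolding standard_triangle_eq_hull by (rule convex_on_convex_hull_bound) (simp add: le_max_iff_disj)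
  then show "F x \<le> ?M"
    using x unfolding standard_triangle_eq_hull by (rule bspec)
qed

text \<open>Integrate along the chords parallel to the side opposite to the origin:
  on each of them \<open>F\<close> lies below its secant.\<close>

lemma integral_standard_triangle_le:
  fixes F :: "real^2 \<Rightarrow> real"
  assumes cF: "convex_on standard_triangle F"
  shows "integral standard_triangle F
    \<le> ((F (vector [1, 0]) + F (vector [1, 1])) / 6
        + (integral {0..1} (\<lambda>s. F (vector [s, 0])) + integral {0..1} (\<lambda>s. F (vector [s, s]))) / 3) / 2"
proof -
  let ?K = "standard_triangle"
  \<comment> \<open>On the open triangle \<open>U\<close> the function \<open>F\<close> is
    continuous, so its extension \<open>G\<close> by zero is Borel measurable and Fubini for
    \<open>lborel\<close> applies to it. The discarded boundary lies on three lines and does not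
    affect the integral.\<close>
  define U :: "(real^2) set" where "U = {v. 0 < v$2 \<and> v$2 < v$1 \<and> v$1 < 1}"
  have UK: "U \<subseteq> ?K" by (auto simp: U_def standard_triangle_def)
  have U_eq: "U = {v. 0 < v$2} \<inter> {v. v$2 < v$1} \<inter> {v. v$1 < 1}"
    by (auto simp: U_def)
  have openU: "open U"
    unfolding U_eq by (intro open_Int open_Collect_less continuous_intros)
  have convU: "convex U"
    unfolding convex_alt
  proof clarify
    fix x y :: "real^2" and u :: real
    assume "x \<in> U" "y \<in> U" "0 \<le> u" "u \<le> 1"
    have strict: "(1 - u) * a + u * b > 0" if "a > 0" "b > 0" for a b :: real
      using that \<open>0 \<le> u\<close> \<open>u \<le> 1\<close>
      by (cases "u = 0") (auto intro: add_nonneg_pos)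
    have "(1 - u) * x$2 + u * y$2 > 0" "(1 - u) * (x$1 - x$2) + u * (y$1 - y$2) > 0"
      "(1 - u) * (1 - x$1) + u * (1 - y$1) > 0"
      using \<open>x \<in> U\<close> \<open>y \<in> U\<close> by (auto intro!: strict simp: U_def)
    then show "(1 - u) *\<^sub>R x + u *\<^sub>R y \<in> U"
      by (auto simp: U_def algebra_simps)
  qed
  have negl: "negligible (?K - U)"
  proof (rule negligible_subset)
    have 1: "negligible {v::real^2. axis 2 1 \<bullet> v = 0}"
      by (intro negligible_hyperplane) (auto simp: axis_eq_0_iff)
    have 2: "negligible {v::real^2. axis 1 1 \<bullet> v = 1}"
      by (intro negligible_hyperplane) (auto simp: axis_eq_0_iff)
    have "vector [1, -1] \<noteq> (0 :: real^2)"
      by (auto simp: vec_eq_iff forall_2)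
    then have 3: "negligible {v::real^2. vector [1, -1] \<bullet> v = 0}"
      by (intro negligible_hyperplane) auto
    show "negligible ({v::real^2. axis 2 1 \<bullet> v = 0} \<union> {v. axis 1 1 \<bullet> v = 1} \<union> {v. vector [1, -1] \<bullet> v = 0})"
      using 1 2 3 by (intro negligible_Un)
    show "?K - U \<subseteq> {v::real^2. axis 2 1 \<bullet> v = 0} \<union> {v. axis 1 1 \<bullet> v = 1} \<union> {v. vector [1, -1] \<bullet> v = 0}"
      by (auto simp: standard_triangle_def U_def inner_vec_def sum_2 axis_def)
  qed
  have intK: "F absolutely_integrable_on ?K"
    using cF by (rule convex_on_standard_triangle_absolutely_integrable)
  have intU: "F absolutely_integrable_on U"
    using intK UK openU by (auto intro: set_integrable_subset)
  have contU: "continuous_on U F"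
    using convex_on_subset[OF cF UK convU] openU by (intro convex_on_continuous)
  define G where "G v = indicator U v * F v" for v
  have G_meas: "G \<in> borel_measurable borel"
    using borel_measurable_continuous_on_indicator[OF _ contU] openU by (simp add: G_def[abs_def])
  have G_int: "integrable lborel G"
  proof -
    have "integrable lebesgue G"
      using intU by (simp add: set_integrable_def G_def[abs_def])
    then show ?thesis
      using G_meas by (simp add: integrable_completion)
  qed
  have K_eq: "integral ?K F = integral\<^sup>L lborel G"
  proof -
    have "integral ?K F = integral U F"
      using negl UK by (intro integral_spike_set) (auto intro: negligible_subset)
    also have "\<dots> = (LINT v:U|lborel. F v)"
      using G_int by (intro set_borel_integral_eq_integral(2)[symmetric]) (simp add: set_integrable_def G_def[abs_def])
    finally show ?thesis by (simp add: set_lebesgue_integral_def G_def[abs_def])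
  qed
  let ?h = "\<lambda>(x, y). vector [x, y] :: real^2"
  have h_meas: "?h \<in> borel_measurable borel"
    by (rule borel_measurable_vector2)
  define H where "H = (\<lambda>p. G (?h p))"
  have H_int: "integrable (lborel \<Otimes>\<^sub>M lborel) H"
    using G_int h_meas G_meas unfolding H_def lborel_prod
    by (subst (asm) lborel_vec2) (simp add: integrable_distr_eq)
  have "integral\<^sup>L lborel G = integral\<^sup>L (lborel \<Otimes>\<^sub>M lborel) H"
    using h_meas G_meas unfolding H_def lborel_prod
    by (subst lborel_vec2) (simp add: integral_distr)
  also have "\<dots> = (LINT s|lborel. LINT t|lborel. H (s, t))"
    using lborel_pair.integral_fst'[OF H_int] by simp
  finally have G_eq: "integral\<^sup>L lborel G = (LINT s|lborel. LINT t|lborel. H (s, t))" .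
  define p where "p s = F (vector [s, 0])" for s
  define q where "q s = F (vector [s, s])" for s
  \<comment> \<open>The slopes \<open>c = 0\<close> and \<open>c = 1\<close> are the two sides
    issuing from the origin, on which \<open>F\<close> becomes \<open>p\<close> and
    \<open>q\<close>.\<close>
  have conv_line: "convex_on {0..1} (\<lambda>s. F (vector [s, c * s]))" if c: "0 \<le> c" "c \<le> 1" for c
  proof -
    have "vector [s, c * s] \<in> ?K" if "s \<in> {0..1}" for s
      using c that by (auto simp: standard_triangle_def mult_left_le_one_le)
    moreover have "vector [(1 - t) * x + t * y, c * ((1 - t) * x + t * y)]
        = (1 - t) *\<^sub>R vector [x, c * x] + t *\<^sub>R (vector [y, c * y] :: real^2)" for t x y
      by (simp add: vec_eq_iff forall_2 algebra_simps)
    ultimately show ?thesis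
      using convex_onD[OF cF] by (intro convex_onI) auto
  qed
  have cp: "convex_on {0..1} p" and cq: "convex_on {0..1} q"
    using conv_line[of 0] conv_line[of 1] by (simp_all add: p_def[abs_def] q_def[abs_def])
  note mp = convex_on_integral_times_id_le[OF cp] and mq = convex_on_integral_times_id_le[OF cq]
  \<comment> \<open>\<open>R s\<close> is the trapezoid value: the integral over a chord of length
    \<open>s\<close> of the affine function with end values \<open>p s\<close> and
    \<open>q s\<close>.\<close>
  define R where "R s = (s * p s + s * q s) / 2" for s
  have R_hi: "(R has_integral (integral {0..1} (\<lambda>s. s * p s) + integral {0..1} (\<lambda>s. s * q s)) / 2) {0..1}"
    unfolding R_def using mp(1) mq(1)
    by (intro has_integral_divide has_integral_add integrable_integral set_lebesgue_integral_eq_integral(1))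
  have R_ai: "R absolutely_integrable_on {0..1}"
    unfolding R_def using mp(1) mq(1)
    by (intro set_integrable_divide set_integral_add)
  \<comment> \<open>A non-integrable slice would receive the default integral 0, which need not lie
    below \<open>R s\<close>. Fubini supplies integrability for almost every \<open>s\<close>, which
    is enough for comparing the outer integrals.\<close>
  have slice: "(LINT t|lborel. H (s, t)) \<le> indicator {0<..<1} s * R s"
    if int: "integrable lborel (\<lambda>t. H (s, t))" for s
  proof (cases "0 < s \<and> s < 1")
    case False
    then have "H (s, t) = 0" for t
      by (auto simp: H_def G_def U_def indicator_def)
    with False show ?thesis by simp
  next
    case True
    \<comment> \<open>The secant on the chord at \<open>s\<close>: it takes the value
      \<open>p s\<close> at \<open>t = 0\<close> and \<open>q s\<close> at
      \<open>t = s\<close>.\<close>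
    define S where "S t = p s + t * ((q s - p s) / s)" for t
    have bound: "F (vector [s, t]) \<le> S t" if t: "0 \<le> t" "t \<le> s" for t
    proof -
      have "F ((1 - t / s) *\<^sub>R vector [s, 0] + (t / s) *\<^sub>R vector [s, s])
          \<le> (1 - t / s) * F (vector [s, 0]) + (t / s) * F (vector [s, s])"
        by (rule convex_onD[OF cF]) (use True t in \<open>auto simp: standard_triangle_def\<close>)
      moreover have "(1 - t / s) *\<^sub>R vector [s, 0] + (t / s) *\<^sub>R vector [s, s] = (vector [s, t] :: real^2)"
        using True by (simp add: vec_eq_iff forall_2 field_simps)
      ultimately show ?thesis
        by (simp add: S_def p_def q_def algebra_simps diff_divide_distrib)
    qed
    have S_hi: "(S has_integral s * p s + (q s - p s) / s * (s^2 / 2)) {0..s}"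
    proof -
      let ?P = "\<lambda>t. t * p s + (q s - p s) / s * (t^2 / 2)"
      have "(S has_integral ?P s - ?P 0) {0..s}"
        unfolding S_def using True
        by (intro fundamental_theorem_of_calculus)
           (auto simp: has_real_derivative_iff_has_vector_derivative[symmetric] intro!: derivative_eq_intros)
      then show ?thesis by simp
    qed
    have "((\<lambda>t. H (s, t)) has_integral (LINT t|lborel. H (s, t))) UNIV"
      using int by (rule has_integral_integral_lborel)
    moreover have "((\<lambda>t. if t \<in> {0<..<s} then S t else 0) has_integral s * p s + (q s - p s) / s * (s^2 / 2)) UNIV"
      using S_hi by (simp only: has_integral_restrict_UNIV has_integral_Icc_iff_Ioo)
    moreover have "H (s, t) \<le> (if t \<in> {0<..<s} then S t else 0)" for t
      using True bound[of t] by (auto simp: H_def G_def U_def indicator_def)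
    ultimately have "(LINT t|lborel. H (s, t)) \<le> s * p s + (q s - p s) / s * (s^2 / 2)"
      by (rule has_integral_le)
    also have "\<dots> = R s"
      using True by (simp add: R_def field_simps power2_eq_square)
    finally show ?thesis using True by simp
  qed
  \<comment> \<open>Integrability of \<open>R\<close> is known with respect to
    \<open>lebesgue\<close>, so the comparison is made there; passing to the completion does not
    change the integral of the left-hand side.\<close>
  have "(LINT s|lborel. LINT t|lborel. H (s, t)) \<le> (LINT s|lebesgue. indicator {0<..<1} s * R s)"
  proof -
    have R_int: "integrable lebesgue (\<lambda>s. indicator {0<..<1} s * R s)"
      using set_integrable_subset[OF R_ai, of "{0<..<1}"] by (simp add: set_integrable_def greaterThanLessThan_subseteq_atLeastAtMost_iff)
    have H_int': "integrable lebesgue (\<lambda>s. LINT t|lborel. H (s, t))"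
      using lborel_pair.integrable_fst'[OF H_int] by (intro integrable_completion[THEN iffD2]) auto
    have "AE s in lebesgue. integrable lborel (\<lambda>t. H (s, t))"
      using lborel_pair.AE_integrable_fst'[OF H_int] by (rule AE_completion)
    then have "AE s in lebesgue. (LINT t|lborel. H (s, t)) \<le> indicator {0<..<1} s * R s"
      by (rule AE_mp) (use slice in auto)
    then have "(LINT s|lebesgue. LINT t|lborel. H (s, t)) \<le> (LINT s|lebesgue. indicator {0<..<1} s * R s)"
      by (rule integral_mono_AE[OF H_int' R_int])
    then show ?thesis
      using lborel_pair.integrable_fst'[OF H_int] by (simp add: integral_completion)
  qed
  also have "\<dots> = integral {0..1} R"
  proof -
    have "(LINT s:{0<..<1}|lebesgue. R s) = integral {0<..<1} R"
      using set_integrable_subset[OF R_ai, of "{0<..<1}"]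
      by (intro set_lebesgue_integral_eq_integral(2)) (auto simp: greaterThanLessThan_subseteq_atLeastAtMost_iff)
    then show ?thesis
      by (simp add: set_lebesgue_integral_def integral_open_interval_real)
  qed
  also have "\<dots> = (integral {0..1} (\<lambda>s. s * p s) + integral {0..1} (\<lambda>s. s * q s)) / 2"
    using R_hi by (rule integral_unique)
  also have "\<dots> \<le> ((p 1 / 6 + integral {0..1} p / 3) + (q 1 / 6 + integral {0..1} q / 3)) / 2"
    using mp(2) mq(2) by simp
  also have "\<dots> = ((p 1 + q 1) / 6 + (integral {0..1} p + integral {0..1} q) / 3) / 2"
    by (simp add: field_simps)
  finally show ?thesis
    by (simp add: K_eq G_eq p_def[abs_def] q_def[abs_def])
qed

section \<open>Transfer to arbitrary triangles\<close>

text \<open>The map sends \<open>0\<close>, \<open>vector [1, 0]\<close> and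
  \<open>vector [1, 1]\<close> to \<open>P\<close>, \<open>X\<close> and \<open>Y\<close>; this is
  why its second direction is \<open>Y - X\<close> rather than \<open>Y - P\<close>.\<close>

lemma triangle_eq_affine_image:
  fixes P X Y :: "real^2"
  shows "convex hull {P, X, Y} = (\<lambda>v. P + (v$1 *\<^sub>R (X - P) + v$2 *\<^sub>R (Y - X))) ` standard_triangle"
    (is "_ = ?\<phi> ` _")
proof -
  have "\<exists>v\<in>standard_triangle. P + s *\<^sub>R (X - P) + t *\<^sub>R (Y - P) = ?\<phi> v"
    if "0 \<le> s" "0 \<le> t" "s + t \<le> 1" for s t
    using that
    by (intro bexI[of _ "vector [s + t, t]"]) (auto simp: standard_triangle_def algebra_simps)
  moreover have "\<exists>s t. ?\<phi> v = P + s *\<^sub>R (X - P) + t *\<^sub>R (Y - P) \<and> 0 \<le> s \<and> 0 \<le> t \<and> s + t \<le> 1"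
    if "v \<in> standard_triangle" for v
    using that
    by - (rule exI[of _ "v$1 - v$2"], rule exI[of _ "v$2"], auto simp: standard_triangle_def algebra_simps)
  ultimately show ?thesis
    unfolding convex_hull_3_alt by (auto simp: image_iff)
qed

text \<open>Pull \<open>f\<close> back along the affine map from the standard triangle. Its Jacobian
  is \<open>d\<close>, twice the signed area, and it carries the two sides at the origin to the
  segments from \<open>P\<close> to \<open>X\<close> and to \<open>Y\<close> with their affine
  parametrisations.\<close>

lemma integral_triangle_le:
  fixes P X Y :: "real^2" and f :: "real^2 \<Rightarrow> real"
  defines "d \<equiv> (X - P)$1 * (Y - P)$2 - (X - P)$2 * (Y - P)$1"
  assumes d: "d \<noteq> 0" and cf: "convex_on (convex hull {P, X, Y}) f"
  shows "f integrable_on convex hull {P, X, Y}"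
    and "integral (convex hull {P, X, Y}) f
      \<le> \<bar>d\<bar> / 2 * ((f X + f Y) / 6 + (avg_seg f P X + avg_seg f P Y) / 3)"
proof -
  let ?K = standard_triangle
  define L where "L v = v$1 *\<^sub>R (X - P) + v$2 *\<^sub>R (Y - X)" for v :: "real^2"
  define \<phi> where "\<phi> v = P + L v" for v
  have T: "convex hull {P, X, Y} = \<phi> ` ?K"
    unfolding \<phi>_def L_def by (rule triangle_eq_affine_image)
  have lin: "linear L"
    by (rule linearI) (auto simp: L_def algebra_simps)
  \<comment> \<open>Using \<open>Y - X\<close> in place of \<open>Y - P\<close> is a column
    operation and leaves the determinant unchanged.\<close>
  have det: "det (matrix L) = d"
    by (simp add: det_2 matrix_def L_def d_def axis_def algebra_simps)
  have "inj L"
    using d det det_nz_iff_inj[OF lin] by simp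
  then have inj: "inj_on \<phi> ?K"
    by (auto simp: inj_on_def \<phi>_def)
  have der: "(\<phi> has_derivative L) (at x within ?K)" for x
    unfolding \<phi>_def using lin
    by (auto intro!: derivative_eq_intros bounded_linear_imp_has_derivative simp: linear_linear)
  define F where "F v = f (\<phi> v)" for v
  have cF: "convex_on ?K F"
  proof (rule convex_onI)
    show "convex ?K"
      by (simp add: standard_triangle_eq_hull convex_convex_hull)
    fix t :: real and x y assume t: "0 < t" "t < 1" and xy: "x \<in> ?K" "y \<in> ?K"
    have "\<phi> ((1 - t) *\<^sub>R x + t *\<^sub>R y) = (1 - t) *\<^sub>R \<phi> x + t *\<^sub>R \<phi> y"
      by (simp add: \<phi>_def L_def algebra_simps)
    moreover have "f ((1 - t) *\<^sub>R \<phi> x + t *\<^sub>R \<phi> y) \<le> (1 - t) * f (\<phi> x) + t * f (\<phi> y)"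
      using t xy by (intro convex_onD[OF cf]) (auto simp: T)
    ultimately show "F ((1 - t) *\<^sub>R x + t *\<^sub>R y) \<le> (1 - t) * F x + t * F y"
      by (simp add: F_def)
  qed
  have "F absolutely_integrable_on ?K"
    using cF by (rule convex_on_standard_triangle_absolutely_integrable)
  then have dF: "(\<lambda>v. \<bar>d\<bar> * F v) absolutely_integrable_on ?K"
    by (intro set_integrable_mult_right) auto
  have meas: "?K \<in> sets lebesgue"
    using compact_standard_triangle by (auto intro: fmeasurableD lmeasurable_compact)
  \<comment> \<open>The change of variables formula concerns vector-valued integrands, so
    \<open>f\<close> is wrapped into \<open>real^1\<close> by \<open>vec\<close> and unwrapped again
    afterwards.\<close>
  have "(\<lambda>x. \<bar>det (matrix L)\<bar> *\<^sub>R (vec (f (\<phi> x)) :: real^1)) absolutely_integrable_on ?K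
      \<and> integral ?K (\<lambda>x. \<bar>det (matrix L)\<bar> *\<^sub>R (vec (f (\<phi> x)) :: real^1)) = vec (integral ?K (\<lambda>v. \<bar>d\<bar> * F v))
    \<longleftrightarrow> (\<lambda>x. vec (f x) :: real^1) absolutely_integrable_on \<phi> ` ?K
      \<and> integral (\<phi> ` ?K) (\<lambda>x. vec (f x) :: real^1) = vec (integral ?K (\<lambda>v. \<bar>d\<bar> * F v))"
    by (rule has_absolute_integral_change_of_variables[OF meas der inj])
  then have "f absolutely_integrable_on \<phi> ` ?K \<and> integral (\<phi> ` ?K) f = integral ?K (\<lambda>v. \<bar>d\<bar> * F v)"
    using dF by (simp add: absolutely_integrable_on_1_iff integral_on_1_eq F_def det vec_eq_iff)
  then have f: "f absolutely_integrable_on convex hull {P, X, Y}"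
    and eq: "integral (convex hull {P, X, Y}) f = \<bar>d\<bar> * integral ?K F"
    by (simp_all add: T)
  show "f integrable_on convex hull {P, X, Y}"
    using f by (rule set_lebesgue_integral_eq_integral(1))
  have "integral (convex hull {P, X, Y}) f \<le> \<bar>d\<bar> * (((F (vector [1, 0]) + F (vector [1, 1])) / 6
        + (integral {0..1} (\<lambda>s. F (vector [s, 0])) + integral {0..1} (\<lambda>s. F (vector [s, s]))) / 3) / 2)"
    unfolding eq by (intro mult_left_mono integral_standard_triangle_le cF) auto
  moreover have "F (vector [s, 0]) = f ((1 - s) *\<^sub>R P + s *\<^sub>R X)" "F (vector [s, s]) = f ((1 - s) *\<^sub>R P + s *\<^sub>R Y)" for s
    by (simp_all add: F_def \<phi>_def L_def algebra_simps)
  ultimately show "integral (convex hull {P, X, Y}) f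
      \<le> \<bar>d\<bar> / 2 * ((f X + f Y) / 6 + (avg_seg f P X + avg_seg f P Y) / 3)"
    by (simp add: avg_seg_def)
qed

lemma measure_triangle:
  fixes P X Y :: "real^2"
  assumes "(X - P)$1 * (Y - P)$2 - (X - P)$2 * (Y - P)$1 \<noteq> 0" (is "?d \<noteq> 0")
  shows "measure lebesgue (convex hull {P, X, Y}) = \<bar>?d\<bar> / 2"
proof -
  let ?T = "convex hull {P, X, Y}"
  have lm: "?T \<in> lmeasurable"
    by (intro lmeasurable_compact compact_convex_hull finite_imp_compact) auto
  have const: "convex_on ?T (\<lambda>_. c)" for c :: real
    by (intro convex_onI convex_convex_hull) (auto simp: algebra_simps)
  txt \<open>The bound is sharp for constants: use it for \<open>1\<close> and \<open>- 1\<close>.\<close>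
  have "integral ?T (\<lambda>_. 1) \<le> \<bar>?d\<bar> / 2" "integral ?T (\<lambda>_. - 1) \<le> - \<bar>?d\<bar> / 2"
    using integral_triangle_le(2)[OF assms const, of 1] integral_triangle_le(2)[OF assms const, of "-1"]
    by (simp_all add: avg_seg_def)
  then show ?thesis
    using lm by (simp add: lmeasure_integral)
qed

section \<open>Segments, collinearity and lines in the plane\<close>

text \<open>The triangle bounds yield averages over half-diagonals leaving the centre; this joins
  them into averages over whole diagonals. The substitutions \<open>1 - 2 * t\<close> and
  \<open>2 * t - 1\<close> identify the halves of the parameter interval with the segments from
  \<open>M\<close>, the first one traversed backwards.\<close>

lemma avg_seg_midpoint:
  fixes X Y M :: "real^2"
  assumes M: "M = (1/2) *\<^sub>R (X + Y)"
    and X: "(\<lambda>t. f ((1 - t) *\<^sub>R M + t *\<^sub>R X)) integrable_on {0..1}"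
    and Y: "(\<lambda>t. f ((1 - t) *\<^sub>R M + t *\<^sub>R Y)) integrable_on {0..1}"
  shows "avg_seg f X Y = (avg_seg f M X + avg_seg f M Y) / 2"
proof -
  have X_half: "((\<lambda>t. f ((1 - t) *\<^sub>R X + t *\<^sub>R Y)) has_integral avg_seg f M X / 2) {0..1/2}"
  proof -
    have "((\<lambda>t. f ((1 - t) *\<^sub>R M + t *\<^sub>R X)) has_integral avg_seg f M X) (cbox 0 1)"
      using X by (simp add: avg_seg_def integrable_integral)
    note hi = has_integral_affinity[OF this, of "- 2" 1]
    have fn: "(1 - (- 2 *\<^sub>R t + 1)) *\<^sub>R M + (- 2 *\<^sub>R t + 1) *\<^sub>R X = (1 - t) *\<^sub>R X + t *\<^sub>R Y" for t :: real
      by (simp add: M vec_eq_iff field_simps)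
    have img: "(\<lambda>x. (1 / - 2) *\<^sub>R x + - ((1 / - 2) *\<^sub>R 1)) ` cbox 0 (1::real) = {0..1/2}"
      using image_affinity_atLeastAtMost[of "1 / - 2 :: real" "- ((1 / - 2) *\<^sub>R 1)" 0 1] by simp
    show ?thesis
      using hi unfolding fn img by simp
  qed
  have Y_half: "((\<lambda>t. f ((1 - t) *\<^sub>R X + t *\<^sub>R Y)) has_integral avg_seg f M Y / 2) {1/2..1}"
  proof -
    have "((\<lambda>t. f ((1 - t) *\<^sub>R M + t *\<^sub>R Y)) has_integral avg_seg f M Y) (cbox 0 1)"
      using Y by (simp add: avg_seg_def integrable_integral)
    note hi = has_integral_affinity[OF this, of 2 "- 1"]
    have fn: "(1 - (2 *\<^sub>R t + (- 1))) *\<^sub>R M + (2 *\<^sub>R t + (- 1)) *\<^sub>R Y = (1 - t) *\<^sub>R X + t *\<^sub>R Y" for t :: real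
      by (simp add: M vec_eq_iff field_simps)
    have img: "(\<lambda>x. (1 / 2) *\<^sub>R x + - ((1 / 2) *\<^sub>R (- 1))) ` cbox 0 (1::real) = {1/2..1}"
      using image_affinity_atLeastAtMost[of "1 / 2 :: real" "- ((1 / 2) *\<^sub>R (- 1))" 0 1] by simp
    show ?thesis
      using hi unfolding fn img by simp
  qed
  have "((\<lambda>t. f ((1 - t) *\<^sub>R X + t *\<^sub>R Y)) has_integral avg_seg f M X / 2 + avg_seg f M Y / 2) {0..1}"
    using has_integral_combine[OF _ _ X_half Y_half] by simp
  then show ?thesis
    by (simp add: avg_seg_def integral_unique add_divide_distrib)
qed

text \<open>If the determinant vanishes and \<open>u\<close> is nonzero, then \<open>v\<close> has
  no component orthogonal to \<open>u\<close>, so it equals its projection onto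
  \<open>u\<close>.\<close>

lemma det2_nonzero_if_not_collinear:
  fixes P X Y :: "real^2"
  assumes "\<not> collinear {P, X, Y}"
  shows "(X - P)$1 * (Y - P)$2 - (X - P)$2 * (Y - P)$1 \<noteq> 0"
proof
  define u where "u = X - P"
  define v where "v = Y - P"
  assume "(X - P)$1 * (Y - P)$2 - (X - P)$2 * (Y - P)$1 = 0"
  then have d: "u$1 * v$2 = u$2 * v$1" by (simp add: u_def v_def)
  have "collinear {0, u, v}"
  proof (cases "u = 0")
    case False
    then have nz: "u \<bullet> u \<noteq> 0" by simp
    have "v = ((u \<bullet> v) / (u \<bullet> u)) *\<^sub>R u"
    proof -
      have "(u \<bullet> u) *\<^sub>R v = (u \<bullet> v) *\<^sub>R u"
        using d by (simp add: vec_eq_iff forall_2 inner_vec_def sum_2) algebra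
      then have "(1 / (u \<bullet> u)) *\<^sub>R ((u \<bullet> u) *\<^sub>R v) = (1 / (u \<bullet> u)) *\<^sub>R ((u \<bullet> v) *\<^sub>R u)"
        by simp
      then show ?thesis using nz by simp
    qed
    then show ?thesis by (metis collinear_lemma)
  qed simp
  then have "collinear {P, X, Y}"
    using collinear_3[of X P Y] by (simp add: u_def v_def insert_commute)
  with assms show False by blast
qed

lemma negligible_line_vec2:
  fixes P b :: "real^2"
  shows "negligible (range (\<lambda>y. P + y *\<^sub>R b))"
proof (cases "b = 0")
  case False
  \<comment> \<open>\<open>n\<close> is \<open>b\<close> turned by a right angle, hence a normal
    vector of the line.\<close>
  define n :: "real^2" where "n = vector [- b$2, b$1]"
  have "n \<noteq> 0" using False by (auto simp: n_def vec_eq_iff forall_2)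
  then have "negligible {x. n \<bullet> x = n \<bullet> P}"
    by (intro negligible_hyperplane) auto
  then show ?thesis
    by (rule negligible_subset) (auto simp: n_def inner_vec_def sum_2 algebra_simps)
qed simp

section \<open>Assembling the four triangles of the parallelogram\<close>

theorem theorem3p3:
  fixes A B C D :: "real^2" and f :: "real^2 \<Rightarrow> real"
  assumes para: "A + C = B + D"
    and nondeg: "\<not> collinear {A, B, D}"
    and cAOB: "convex_on (convex hull {A, (1/2) *\<^sub>R (A + C), B}) f"
    and cBOC: "convex_on (convex hull {B, (1/2) *\<^sub>R (A + C), C}) f"
    and cCOD: "convex_on (convex hull {C, (1/2) *\<^sub>R (A + C), D}) f"
    and cDOA: "convex_on (convex hull {D, (1/2) *\<^sub>R (A + C), A}) f"
  shows "avg2 f (convex hull {A, B, C, D})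
           \<le> (1/3) * ((f A + f B + f C + f D) / 4)
             + (2/3) * ((avg_seg f A C + avg_seg f B D) / 2)"
proof -
  \<comment> \<open>In coordinates centred at \<open>P\<close> with axes along the diagonals, the
    vertices are \<open>P + a\<close>, \<open>P + b\<close>, \<open>P - a\<close> and
    \<open>P - b\<close>.\<close>
  define P where "P = (1/2) *\<^sub>R (A + C)"
  define a where "a = A - P"
  define b where "b = B - P"
  define d where "d = a$1 * b$2 - a$2 * b$1"
  have A: "A = P + a" and B: "B = P + b"
    by (simp_all add: a_def b_def)
  have C: "C = P - a"
    by (simp add: a_def P_def vec_eq_iff field_simps)
  have D: "D = P - b"
  proof -
    have "D = A + C - B" using para by simp
    then show ?thesis by (simp add: b_def P_def vec_eq_iff field_simps)
  qed
  have d: "d \<noteq> 0"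
  proof -
    have "(B - A)$1 * (D - A)$2 - (B - A)$2 * (D - A)$1 = 2 * d"
      by (simp add: A B D d_def algebra_simps)
    then show ?thesis
      using det2_nonzero_if_not_collinear[OF nondeg] by simp
  qed
  have coord_unique: "x = x' \<and> y = y'"
    if "P + x *\<^sub>R a + y *\<^sub>R b = P + x' *\<^sub>R a + y' *\<^sub>R b" for x y x' y'
  proof -
    have e: "(x - x') *\<^sub>R a = (y' - y) *\<^sub>R b" using that by (simp add: algebra_simps)
    then have "(x - x') * a$1 = (y' - y) * b$1" "(x - x') * a$2 = (y' - y) * b$2"
      by (auto simp: vec_eq_iff)
    then have "(x - x') * d = 0" "(y' - y) * d = 0"
      unfolding d_def by algebra+
    with d show ?thesis by simp
  qed
  \<comment> \<open>The four triangles are indexed by the signs of their coordinates along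
    \<open>a\<close> and \<open>b\<close>, so they can be treated uniformly.\<close>
  define I :: "(real \<times> real) set" where "I = {(1, 1), (-1, 1), (-1, -1), (1, -1)}"
  define T where "T = (\<lambda>(\<sigma>, \<tau>). convex hull {P, P + \<sigma> *\<^sub>R a, P + \<tau> *\<^sub>R b})"
  have I: "i \<in> I \<Longrightarrow> fst i \<in> {-1, 1} \<and> snd i \<in> {-1, 1}" for i
    by (auto simp: I_def)
  have T_coord: "\<exists>x y. p = P + x *\<^sub>R a + y *\<^sub>R b \<and> 0 \<le> \<sigma> * x \<and> 0 \<le> \<tau> * y"
    if "p \<in> T (\<sigma>, \<tau>)" "\<sigma> \<in> {-1, 1}" "\<tau> \<in> {-1, 1}" for p \<sigma> \<tau>
  proof -
    from that(1) obtain u v where "p = P + u *\<^sub>R (\<sigma> *\<^sub>R a) + v *\<^sub>R (\<tau> *\<^sub>R b)" "0 \<le> u" "0 \<le> v"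
      unfolding T_def convex_hull_3_alt by auto
    with that(2,3) show ?thesis
      by (intro exI[of _ "u * \<sigma>"] exI[of _ "v * \<tau>"]) auto
  qed
  \<comment> \<open>Distinct sign pairs differ in some component. The corresponding coordinate of a
    common point has both signs, so it is zero and the point lies on one of the diagonal
    lines.\<close>
  have neg: "negligible (T i \<inter> T j)" if i: "i \<in> I" and j: "j \<in> I" and ij: "i \<noteq> j" for i j
  proof (rule negligible_subset)
    show "negligible (range (\<lambda>x. P + x *\<^sub>R a) \<union> range (\<lambda>y. P + y *\<^sub>R b))"
      by (intro negligible_Un negligible_line_vec2)
    show "T i \<inter> T j \<subseteq> range (\<lambda>x. P + x *\<^sub>R a) \<union> range (\<lambda>y. P + y *\<^sub>R b)"
    proof clarify
      fix p assume p: "p \<in> T i" "p \<in> T j" and nb: "p \<notin> range (\<lambda>y. P + y *\<^sub>R b)"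
      obtain x y where xy: "p = P + x *\<^sub>R a + y *\<^sub>R b" "0 \<le> fst i * x" "0 \<le> snd i * y"
        using T_coord[of p "fst i" "snd i"] p(1) I[OF i] by auto
      obtain x' y' where xy': "p = P + x' *\<^sub>R a + y' *\<^sub>R b" "0 \<le> fst j * x'" "0 \<le> snd j * y'"
        using T_coord[of p "fst j" "snd j"] p(2) I[OF j] by auto
      have same: "x' = x" "y' = y"
        using coord_unique[of x y x' y'] xy(1) xy'(1) by auto
      have "x \<noteq> 0" using nb xy(1) by auto
      then have "fst i = fst j"
        using xy(2) xy'(2) I[OF i] I[OF j] by (auto simp: same)
      then have "snd i \<noteq> snd j" using ij by (auto simp: prod_eq_iff)
      then have "y = 0"
        using xy(3) xy'(3) I[OF i] I[OF j] by (auto simp: same)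
      then show "p \<in> range (\<lambda>x. P + x *\<^sub>R a)" using xy(1) by auto
    qed
  qed
  have union: "convex hull {A, B, C, D} = (\<Union>i\<in>I. T i)"
  proof
    \<comment> \<open>\<open>?Q\<close> is the unit ball of the sum norm in these coordinates. It
      serves as an intermediate set: it is convex and contains the vertices, and splitting it by
      signs gives the triangles.\<close>
    let ?Q = "{P + x *\<^sub>R a + y *\<^sub>R b |x y. \<bar>x\<bar> + \<bar>y\<bar> \<le> 1}"
    have "convex ?Q"
    proof (rule convexI)
      fix p q and u v :: real
      assume "p \<in> ?Q" "q \<in> ?Q" and uv: "0 \<le> u" "0 \<le> v" "u + v = 1"
      then obtain x y x' y' where p: "p = P + x *\<^sub>R a + y *\<^sub>R b" "\<bar>x\<bar> + \<bar>y\<bar> \<le> 1"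
        and q: "q = P + x' *\<^sub>R a + y' *\<^sub>R b" "\<bar>x'\<bar> + \<bar>y'\<bar> \<le> 1" by blast
      have "u *\<^sub>R p + v *\<^sub>R q = (u + v) *\<^sub>R P + (u * x + v * x') *\<^sub>R a + (u * y + v * y') *\<^sub>R b"
        by (simp add: p q algebra_simps)
      moreover have "\<bar>u * x + v * x'\<bar> + \<bar>u * y + v * y'\<bar> \<le> 1"
      proof -
        have "\<bar>u * x + v * x'\<bar> + \<bar>u * y + v * y'\<bar> \<le> (u * \<bar>x\<bar> + v * \<bar>x'\<bar>) + (u * \<bar>y\<bar> + v * \<bar>y'\<bar>)"
          using uv abs_triangle_ineq[of "u * x" "v * x'"] abs_triangle_ineq[of "u * y" "v * y'"]
          by (simp add: abs_mult)
        also have "\<dots> = u * (\<bar>x\<bar> + \<bar>y\<bar>) + v * (\<bar>x'\<bar> + \<bar>y'\<bar>)" by (simp add: algebra_simps)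
        also have "\<dots> \<le> u * 1 + v * 1"
          using uv p q by (intro add_mono mult_left_mono) auto
        finally show ?thesis using uv by simp
      qed
      ultimately show "u *\<^sub>R p + v *\<^sub>R q \<in> ?Q" using uv(3) by auto
    qed
    moreover have "{A, B, C, D} \<subseteq> ?Q"
    proof -
      have "P + x *\<^sub>R a + y *\<^sub>R b \<in> ?Q" if "\<bar>x\<bar> + \<bar>y\<bar> \<le> 1" for x y using that by blast
      from this[of 1 0] this[of "-1" 0] this[of 0 1] this[of 0 "-1"]
      show ?thesis by (simp add: A B C D)
    qed
    ultimately have "convex hull {A, B, C, D} \<subseteq> ?Q" by (rule hull_minimal[rotated])
    also have "?Q \<subseteq> (\<Union>i\<in>I. T i)"
    proof clarify
      fix x y :: real assume xy: "\<bar>x\<bar> + \<bar>y\<bar> \<le> 1"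
      define \<sigma> :: real where "\<sigma> = (if x \<ge> 0 then 1 else -1)"
      define \<tau> :: real where "\<tau> = (if y \<ge> 0 then 1 else -1)"
      have "P + x *\<^sub>R a + y *\<^sub>R b = P + \<bar>x\<bar> *\<^sub>R (P + \<sigma> *\<^sub>R a - P) + \<bar>y\<bar> *\<^sub>R (P + \<tau> *\<^sub>R b - P)"
        by (simp add: \<sigma>_def \<tau>_def)
      then have "P + x *\<^sub>R a + y *\<^sub>R b \<in> T (\<sigma>, \<tau>)"
        unfolding T_def convex_hull_3_alt using xy by fastforce
      moreover have "(\<sigma>, \<tau>) \<in> I" by (auto simp: I_def \<sigma>_def \<tau>_def)
      ultimately show "P + x *\<^sub>R a + y *\<^sub>R b \<in> (\<Union>i\<in>I. T i)" by blast
    qed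
    finally show "convex hull {A, B, C, D} \<subseteq> (\<Union>i\<in>I. T i)" .
    have "P \<in> convex hull {A, C}"
      unfolding convex_hull_2 by (auto simp: P_def scaleR_add_right intro!: exI[of _ "1/2::real"])
    then have "P \<in> convex hull {A, B, C, D}"
      using hull_mono[of "{A, C}" "{A, B, C, D}" convex] by auto
    then have "{P, P + \<sigma> *\<^sub>R a, P + \<tau> *\<^sub>R b} \<subseteq> convex hull {A, B, C, D}"
      if "(\<sigma>, \<tau>) \<in> I" for \<sigma> \<tau>
      using that hull_subset[of "{A, B, C, D}" convex] by (auto simp: I_def A B C D)
    then have "T (\<sigma>, \<tau>) \<subseteq> convex hull {A, B, C, D}" if "(\<sigma>, \<tau>) \<in> I" for \<sigma> \<tau>
      unfolding T_def prod.case using that by (intro hull_minimal convex_convex_hull)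
    then show "(\<Union>i\<in>I. T i) \<subseteq> convex hull {A, B, C, D}"
      by (auto simp: subset_iff)
  qed
  have "T (1, 1) = convex hull {A, P, B}" "T (-1, 1) = convex hull {B, P, C}"
    "T (-1, -1) = convex hull {C, P, D}" "T (1, -1) = convex hull {D, P, A}"
    by (simp_all add: T_def A B C D insert_commute)
  then have cT: "convex_on (T i) f" if "i \<in> I" for i
    using that cAOB cBOC cCOD cDOA unfolding I_def P_def[symmetric] by auto
  have dT: "((P + \<sigma> *\<^sub>R a) - P)$1 * ((P + \<tau> *\<^sub>R b) - P)$2 - ((P + \<sigma> *\<^sub>R a) - P)$2 * ((P + \<tau> *\<^sub>R b) - P)$1 = \<sigma> * \<tau> * d" for \<sigma> \<tau>
    by (simp add: d_def algebra_simps)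
  have abs_d: "\<bar>\<sigma> * \<tau> * d\<bar> = \<bar>d\<bar>" "\<sigma> * \<tau> * d \<noteq> 0" if "(\<sigma>, \<tau>) \<in> I" for \<sigma> \<tau>
    using I[OF that] d by (auto simp: abs_mult)
  have fT: "f integrable_on T i" if "i \<in> I" for i
    using integral_triangle_le(1)[of "P + fst i *\<^sub>R a" P "P + snd i *\<^sub>R b" f, unfolded dT]
      cT[OF that] abs_d[of "fst i" "snd i"] that
    by (simp add: T_def case_prod_beta)
  have leT: "integral (T (\<sigma>, \<tau>)) f \<le> \<bar>d\<bar> / 2 * ((f (P + \<sigma> *\<^sub>R a) + f (P + \<tau> *\<^sub>R b)) / 6
      + (avg_seg f P (P + \<sigma> *\<^sub>R a) + avg_seg f P (P + \<tau> *\<^sub>R b)) / 3)" if "(\<sigma>, \<tau>) \<in> I" for \<sigma> \<tau>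
    using integral_triangle_le(2)[of "P + \<sigma> *\<^sub>R a" P "P + \<tau> *\<^sub>R b" f, unfolded dT, OF abs_d(2)[OF that]] cT[OF that]
      abs_d(1)[OF that]
    by (simp add: T_def)
  have lT: "T i \<in> lmeasurable" for i
    unfolding T_def case_prod_beta
    by (intro lmeasurable_compact compact_convex_hull finite_imp_compact) auto
  have mT: "measure lebesgue (T i) = \<bar>d\<bar> / 2" if "i \<in> I" for i
    using measure_triangle[of "P + fst i *\<^sub>R a" P "P + snd i *\<^sub>R b", unfolded dT] abs_d[of "fst i" "snd i"] that
    by (simp add: T_def case_prod_beta)
  have pw: "pairwise (\<lambda>i j. negligible (T i \<inter> T j)) I"
    using neg by (auto simp: pairwise_def)
  have finI: "finite I" by (simp add: I_def)
  have "(f has_integral (\<Sum>i\<in>I. integral (T i) f)) (\<Union>i\<in>I. T i)"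
    using fT by (intro has_integral_UN[OF finI _ pw] integrable_integral)
  then have "integral (convex hull {A, B, C, D}) f = (\<Sum>i\<in>I. integral (T i) f)"
    by (simp add: union integral_unique)
  also have "\<dots> = integral (T (1, 1)) f + integral (T (-1, 1)) f + integral (T (-1, -1)) f + integral (T (1, -1)) f"
    by (simp add: I_def)
  also have "\<dots> \<le> \<bar>d\<bar> / 2 * ((f A + f B) / 6 + (avg_seg f P A + avg_seg f P B) / 3)
      + \<bar>d\<bar> / 2 * ((f C + f B) / 6 + (avg_seg f P C + avg_seg f P B) / 3)
      + \<bar>d\<bar> / 2 * ((f C + f D) / 6 + (avg_seg f P C + avg_seg f P D) / 3)
      + \<bar>d\<bar> / 2 * ((f A + f D) / 6 + (avg_seg f P A + avg_seg f P D) / 3)"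
    using leT[of 1 1] leT[of "-1" 1] leT[of "-1" "-1"] leT[of 1 "-1"]
    by (intro add_mono) (simp_all add: I_def A B C D)
  \<comment> \<open>Each vertex and each half-diagonal belongs to exactly two of the triangles. The
    factor \<open>2 * \<bar>d\<bar>\<close> pulled out is the area of the parallelogram, established
    below.\<close>
  also have "\<dots> = 2 * \<bar>d\<bar> * ((f A + f B + f C + f D) / 12
      + (avg_seg f P A + avg_seg f P B + avg_seg f P C + avg_seg f P D) / 6)"
    by (simp add: field_simps)
  finally have int_le: "integral (convex hull {A, B, C, D}) f \<le> 2 * \<bar>d\<bar> * ((f A + f B + f C + f D) / 12
      + (avg_seg f P A + avg_seg f P B + avg_seg f P C + avg_seg f P D) / 6)" .
  have "((\<lambda>_. 1::real) has_integral (\<Sum>i\<in>I. \<bar>d\<bar> / 2)) (\<Union>i\<in>I. T i)"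
  proof (rule has_integral_UN[OF finI _ pw])
    fix i assume "i \<in> I"
    then show "((\<lambda>_. 1::real) has_integral \<bar>d\<bar> / 2) (T i)"
      using lT[of i] mT[of i]
      by (metis integrable_integral integrable_on_const lmeasure_integral)
  qed
  moreover have "convex hull {A, B, C, D} \<in> lmeasurable"
    by (intro lmeasurable_compact compact_convex_hull finite_imp_compact) auto
  ultimately have meas: "measure lebesgue (convex hull {A, B, C, D}) = 2 * \<bar>d\<bar>"
    by (simp add: lmeasure_integral union integral_unique I_def)
  \<comment> \<open>Along a segment inside a set where \<open>f\<close> is convex, \<open>f\<close>
    is a convex function of the parameter and hence integrable, as \<open>avg_seg_midpoint\<close>
    requires.\<close>
  have edge: "(\<lambda>t. f ((1 - t) *\<^sub>R P + t *\<^sub>R Z)) integrable_on {0..1}"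
    if "convex_on S f" "P \<in> S" "Z \<in> S" for Z S
  proof -
    have "convex_on {0..1} (\<lambda>t. f ((1 - t) *\<^sub>R P + t *\<^sub>R Z))"
    proof (rule convex_onI)
      fix t x y :: real assume t: "0 < t" "t < 1" and xy: "x \<in> {0..1}" "y \<in> {0..1}"
      have S: "(1 - z) *\<^sub>R P + z *\<^sub>R Z \<in> S" if "z \<in> {0..1}" for z
        using convex_on_imp_convex[OF \<open>convex_on S f\<close>] \<open>P \<in> S\<close> \<open>Z \<in> S\<close> that by (auto simp: convex_alt)
      have "(1 - ((1 - t) *\<^sub>R x + t *\<^sub>R y)) *\<^sub>R P + ((1 - t) *\<^sub>R x + t *\<^sub>R y) *\<^sub>R Z
          = (1 - t) *\<^sub>R ((1 - x) *\<^sub>R P + x *\<^sub>R Z) + t *\<^sub>R ((1 - y) *\<^sub>R P + y *\<^sub>R Z)"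
        by (simp add: algebra_simps)
      then show "f ((1 - ((1 - t) *\<^sub>R x + t *\<^sub>R y)) *\<^sub>R P + ((1 - t) *\<^sub>R x + t *\<^sub>R y) *\<^sub>R Z)
          \<le> (1 - t) * f ((1 - x) *\<^sub>R P + x *\<^sub>R Z) + t * f ((1 - y) *\<^sub>R P + y *\<^sub>R Z)"
        using convex_onD[OF \<open>convex_on S f\<close> _ _ S[OF xy(1)] S[OF xy(2)], of t] t by simp
    qed simp
    then show ?thesis
      by (intro set_lebesgue_integral_eq_integral(1) convex_on_Icc_absolutely_integrable)
  qed
  \<comment> \<open>The triangles \<open>AOB\<close> and \<open>COD\<close> together contain all
    four half-diagonals.\<close>
  have edges: "(\<lambda>t. f ((1 - t) *\<^sub>R P + t *\<^sub>R Z)) integrable_on {0..1}" if "Z \<in> {A, B, C, D}" for Z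
    using that edge[OF cAOB] edge[OF cCOD] by (auto simp: P_def[symmetric] hull_inc)
  have "avg_seg f A C = (avg_seg f P A + avg_seg f P C) / 2"
    using edges by (intro avg_seg_midpoint) (auto simp: P_def)
  moreover have "avg_seg f B D = (avg_seg f P B + avg_seg f P D) / 2"
    using edges para by (intro avg_seg_midpoint) (auto simp: P_def)
  moreover have "avg2 f (convex hull {A, B, C, D}) \<le> (f A + f B + f C + f D) / 12
      + (avg_seg f P A + avg_seg f P B + avg_seg f P C + avg_seg f P D) / 6"
    using int_le d by (simp add: avg2_def meas divide_le_eq mult_ac)
  ultimately show ?thesis
    by (simp add: field_simps)
qed

end
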